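(* Let $i \geq 1$ be an integer and let $a_1,\dots,a_i,b_1,\dots,b_i \in \mathbb{C}\setminus\mathbb{Z}_{<0}$ satisfy $a_1+\cdots+a_i=b_1+\cdots+b_i$ and $a_1^2+\cdots+a_i^2=b_1^2+\cdots+b_i^2$. Then $$\prod_{n=1}^{\infty}\left[\frac{(n+a_1)\cdots(n+a_i)}{(n+b_1)\cdots(n+b_i)}\right]^{n}=\frac{G(a_1+1)\cdots G(a_i+1)}{G(b_1+1)\cdots G(b_i+1)},$$ where $G$ is the Barnes G-function.
   Context: The Barnes G-function $G$ is the entire function given for all $z\in\mathbb{C}$ by $$G(z+1)=(2\pi)^{z/2}\exp\left(-\frac{z+z^{2}(1+\gamma)}{2}\right)\prod_{n=1}^{\infty}\left\{\left(1+\frac{z}{n}\right)^{n}\exp\left(\frac{z^{2}}{2n}-z\right)\right\},$$ where $\gamma$ is the Euler–Mascheroni constant. It satisfies $G(1)=1$ and $G(z+1)=\Gamma(z)G(z)$. $\mathbb{Z}_{<0}$ denotes the negative integers. The infinite product is the limit of its partial products. *)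

theory Defs
  imports "HOL-Analysis.Analysis"
begin

text \<open>
  The defining formula gives \<open>G (w + 1)\<close>; here it is read at \<open>w = z - 1\<close>.
  The infinite product is the limit of its partial products, which exists for every \<open>w\<close>
  (including the zeros of \<open>G\<close>, where the partial products are eventually \<open>0\<close>).
\<close>

definition Barnes_G :: "complex \<Rightarrow> complex" where
  "Barnes_G z = (let w = z - 1 in
     complex_of_real (2 * pi) powr (w / 2) *
     exp (- ((w + w ^ 2 * (1 + euler_mascheroni)) / 2)) *
     lim (\<lambda>N. \<Prod>n=1..N. (1 + w / of_nat n) ^ n * exp (w ^ 2 / (2 * of_nat n) - w)))"

end

theory Submission
  imports Defs
begin

text \<open>
  When \<open>w\<close> is not a negative integer, the \<open>n\<close>-th factor of the Barnes product is the exponential of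
  \<open>n Ln (1 + w / n) + w\<^sup>2 / (2 n) - w\<close>, which is \<open>O(1 / n\<^sup>2)\<close> by the Taylor expansion of the
  logarithm; so the partial products converge to a nonzero limit. In the quotient of the products
  over the \<open>a\<^sub>j\<close> and the \<open>b\<^sub>j\<close>, all exponential factors cancel because they only depend on the first
  two power sums.
\<close>

text \<open>The terms of degree at least 3 in the logarithm series are dominated by the geometric
  series with first term \<open>norm z ^ 3\<close>.\<close>

lemma Ln_approx_quadratic:
  fixes z :: complex
  assumes "norm z < 1"
  shows "norm (Ln (1 + z) - z + z ^ 2 / 2) \<le> norm z ^ 3 / (1 - norm z)"
proof -
  let ?f = "\<lambda>n. - ((- z) ^ n) / of_nat n"
  have "?f sums Ln (1 + z)"
    by (rule Ln_series') (use assms in auto)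
  then have "(\<lambda>n. ?f (n + 3)) sums (Ln (1 + z) - (\<Sum>n<3. ?f n))"
    by (rule sums_split_initial_segment)
  \<comment> \<open>The term with index 0 is a division by zero, hence 0.\<close>
  also have "(\<Sum>n<3. ?f n) = z - z ^ 2 / 2"
    by (simp add: numeral_3_eq_3 power2_eq_square)
  finally have tail: "(\<lambda>n. ?f (n + 3)) sums (Ln (1 + z) - z + z ^ 2 / 2)"
    by (simp add: algebra_simps)
  have geo: "(\<lambda>n. norm z ^ 3 * norm z ^ n) sums (norm z ^ 3 * (1 / (1 - norm z)))"
    using assms by (intro sums_mult geometric_sums) auto
  have bound: "norm (?f (n + 3)) \<le> norm z ^ 3 * norm z ^ n" for n
  proof -
    have "norm (?f (n + 3)) = norm z ^ (n + 3) / real (n + 3)"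
      by (simp only: norm_divide norm_minus_cancel norm_power norm_of_nat)
    also have "\<dots> \<le> norm z ^ (n + 3) / 1"
      by (intro divide_left_mono) auto
    finally show ?thesis
      by (simp only: power_add div_by_1 mult.commute)
  qed
  have "norm (\<Sum>n. ?f (n + 3)) \<le> (\<Sum>n. norm z ^ 3 * norm z ^ n)"
    by (rule norm_suminf_le[OF bound sums_summable[OF geo]])
  then show ?thesis
    unfolding sums_unique[OF tail, symmetric] sums_unique[OF geo, symmetric] by simp
qed

text \<open>A logarithm of the n-th Barnes factor, though not always the principal one: only its
  exponential matters. At \<open>n = 0\<close> it has the junk value \<open>- w\<close>.\<close>

definition Barnes_log_factor :: "complex \<Rightarrow> nat \<Rightarrow> complex" where
  "Barnes_log_factor w n = of_nat n * Ln (1 + w / of_nat n) + w ^ 2 / (2 * of_nat n) - w"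

lemma summable_Barnes_log_factor: "summable (Barnes_log_factor w)"
proof (rule summable_comparison_test_ev)
  show "summable (\<lambda>n. 2 * norm w ^ 3 * inverse (real n ^ 2))"
    by (intro summable_mult inverse_power_summable) simp
  show "eventually (\<lambda>n. norm (Barnes_log_factor w n) \<le> 2 * norm w ^ 3 * inverse (real n ^ 2))
          sequentially"
    \<comment> \<open>From this index on, \<open>w / n\<close> has norm at most 1/2, so the
      denominator in the cubic bound is at least 1/2; this gives the constant 2.\<close>
    using eventually_ge_at_top[of "nat \<lceil>2 * norm w\<rceil> + 1"]
  proof eventually_elim
    case (elim n)
    then have n: "n > 0" "2 * norm w \<le> real n"
      by linarith+
    let ?z = "w / of_nat n"
    have z: "norm ?z \<le> 1 / 2"
      using n by (simp add: norm_divide field_simps)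
    have "Barnes_log_factor w n = of_nat n * (Ln (1 + ?z) - ?z + ?z ^ 2 / 2)"
      using n(1) by (simp add: Barnes_log_factor_def field_simps power2_eq_square)
    then have "norm (Barnes_log_factor w n) = real n * norm (Ln (1 + ?z) - ?z + ?z ^ 2 / 2)"
      by (simp only: norm_mult norm_of_nat)
    also have "\<dots> \<le> real n * (norm ?z ^ 3 / (1 - norm ?z))"
      using z by (intro mult_left_mono Ln_approx_quadratic) auto
    also have "\<dots> \<le> real n * (norm ?z ^ 3 / (1 / 2))"
      using z by (intro mult_left_mono divide_left_mono) auto
    also have "\<dots> = 2 * norm w ^ 3 * inverse (real n ^ 2)"
      using n(1) by (simp add: norm_divide power3_eq_cube power2_eq_square field_simps)
    finally show ?case .
  qed
qed

definition Barnes_factor :: "complex \<Rightarrow> nat \<Rightarrow> complex" where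
  "Barnes_factor w n = (1 + w / of_nat n) ^ n * exp (w ^ 2 / (2 * of_nat n) - w)"

text \<open>As \<open>w\<close> is not a negative integer, \<open>1 + w / n\<close> is nonzero and
  \<open>exp\<close> inverts \<open>Ln\<close> there. The branch is harmless because the exponent
  \<open>n\<close> is an integer.\<close>

lemma exp_Barnes_log_factor:
  assumes "w \<notin> complex_of_int ` {..<0}" "n > 0"
  shows "exp (Barnes_log_factor w n) = Barnes_factor w n"
proof -
  have "1 + w / of_nat n \<noteq> 0"
  proof
    assume "1 + w / of_nat n = 0"
    then have "w = complex_of_int (- int n)"
      using assms(2) by (simp add: field_simps add_eq_0_iff)
    moreover have "- int n \<in> {..<0}"
      using assms(2) by simp
    ultimately show False
      using assms(1) by blast
  qed
  then have "exp (of_nat n * Ln (1 + w / of_nat n)) = (1 + w / of_nat n) ^ n"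
    by (simp add: exp_of_nat_mult)
  then show ?thesis
    by (simp add: Barnes_log_factor_def Barnes_factor_def exp_add exp_diff)
qed

lemma Barnes_product_tendsto_nonzero:
  assumes "w \<notin> complex_of_int ` {..<0}"
  obtains L where "L \<noteq> 0" "(\<lambda>N. \<Prod>n=1..N. Barnes_factor w n) \<longlonglongrightarrow> L"
proof -
  \<comment> \<open>The shift by \<open>Suc\<close> leaves out the junk value at 0. The limit of the
    products is then an exponential, hence nonzero.\<close>
  have "(\<lambda>N. \<Sum>n<N. Barnes_log_factor w (Suc n)) \<longlonglongrightarrow> (\<Sum>n. Barnes_log_factor w (Suc n))"
    using summable_Barnes_log_factor[of w] by (intro summable_LIMSEQ) (simp add: summable_Suc_iff)
  then have "(\<lambda>N. exp (\<Sum>n<N. Barnes_log_factor w (Suc n)))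
               \<longlonglongrightarrow> exp (\<Sum>n. Barnes_log_factor w (Suc n))"
    by (rule tendsto_exp)
  also have "(\<lambda>N. exp (\<Sum>n<N. Barnes_log_factor w (Suc n))) = (\<lambda>N. \<Prod>n=1..N. Barnes_factor w n)"
    using assms by (simp add: exp_sum exp_Barnes_log_factor prod.atLeast1_atMost_eq)
  finally show ?thesis
    using that exp_not_eq_zero by blast
qed

definition Barnes_prefactor :: "complex \<Rightarrow> complex" where
  "Barnes_prefactor w =
     of_real (2 * pi) powr (w / 2) * exp (- ((w + w ^ 2 * (1 + euler_mascheroni)) / 2))"

lemma Barnes_prefactor_nonzero: "Barnes_prefactor w \<noteq> 0"
  by (simp add: Barnes_prefactor_def)

text \<open>Convergence turns the \<open>lim\<close> in \<open>Barnes_G\<close> into a genuine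
  limit. Nonvanishing is what later allows division by the values at the \<open>b j\<close>.\<close>

lemma Barnes_product_tendsto:
  assumes "w \<notin> complex_of_int ` {..<0}"
  shows "(\<lambda>N. \<Prod>n=1..N. Barnes_factor w n) \<longlonglongrightarrow> Barnes_G (w + 1) / Barnes_prefactor w"
    and "Barnes_G (w + 1) \<noteq> 0"
proof -
  obtain L where L: "L \<noteq> 0" "(\<lambda>N. \<Prod>n=1..N. Barnes_factor w n) \<longlonglongrightarrow> L"
    using Barnes_product_tendsto_nonzero[OF assms] .
  have "Barnes_G (w + 1) = Barnes_prefactor w * lim (\<lambda>N. \<Prod>n=1..N. Barnes_factor w n)"
    by (simp only: Barnes_G_def Barnes_prefactor_def Barnes_factor_def Let_def add_diff_cancel_right')
  also have "lim (\<lambda>N. \<Prod>n=1..N. Barnes_factor w n) = L"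
    by (rule limI[OF L(2)])
  finally show "(\<lambda>N. \<Prod>n=1..N. Barnes_factor w n) \<longlonglongrightarrow> Barnes_G (w + 1) / Barnes_prefactor w"
    and "Barnes_G (w + 1) \<noteq> 0"
    using L Barnes_prefactor_nonzero[of w] by simp_all
qed

text \<open>The exponent of a single prefactor is a linear combination of \<open>w\<close> and
  \<open>w ^ 2\<close>, so the product sees only the first two power sums.\<close>

lemma prod_Barnes_prefactor:
  assumes "finite A"
  shows "(\<Prod>j\<in>A. Barnes_prefactor (a j)) =
     exp ((\<Sum>j\<in>A. a j) / 2 * Ln (of_real (2 * pi)) -
          ((\<Sum>j\<in>A. a j) + (\<Sum>j\<in>A. a j ^ 2) * (1 + euler_mascheroni)) / 2)"
proof -
  have "Barnes_prefactor w =
      exp (w / 2 * Ln (of_real (2 * pi)) - (w + w ^ 2 * (1 + euler_mascheroni)) / 2)" for w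
    by (simp add: Barnes_prefactor_def powr_def exp_add[symmetric] del: of_real_mult)
  then show ?thesis
    using assms
    by (simp add: exp_sum[symmetric] sum_subtractf sum.distrib
          flip: sum_divide_distrib sum_distrib_right)
qed

text \<open>Isolates the product of the \<open>n + a j\<close>; what remains depends only on
  \<open>n\<close>, \<open>card A\<close> and the two power sums, so it cancels between the two
  families.\<close>

lemma prod_Barnes_factor:
  assumes "finite A" "n > 0"
  shows "(\<Prod>j\<in>A. Barnes_factor (a j) n) =
     (\<Prod>j\<in>A. of_nat n + a j) ^ n / of_nat n ^ (card A * n) *
     exp ((\<Sum>j\<in>A. a j ^ 2) / (2 * of_nat n) - (\<Sum>j\<in>A. a j))"
proof -
  have "(\<Prod>j\<in>A. 1 + a j / of_nat n) = (\<Prod>j\<in>A. (of_nat n + a j) / of_nat n)"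
    using assms(2) by (intro prod.cong) (auto simp: field_simps)
  also have "\<dots> = (\<Prod>j\<in>A. of_nat n + a j) / of_nat n ^ card A"
    by (simp add: prod_dividef)
  finally show ?thesis
    unfolding Barnes_factor_def prod.distrib exp_sum[OF assms(1), symmetric] sum_subtractf
      sum_divide_distrib prod_power_distrib[symmetric]
    by (simp add: power_divide power_mult)
qed

theorem theorem3p1:
  fixes i :: nat and a b :: "nat \<Rightarrow> complex"
  assumes "i \<ge> 1"
    and "\<And>j. j \<in> {1..i} \<Longrightarrow> a j \<notin> complex_of_int ` {..<0}"
    and "\<And>j. j \<in> {1..i} \<Longrightarrow> b j \<notin> complex_of_int ` {..<0}"
    and "(\<Sum>j=1..i. a j) = (\<Sum>j=1..i. b j)"
    and "(\<Sum>j=1..i. a j ^ 2) = (\<Sum>j=1..i. b j ^ 2)"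
  shows "(\<lambda>N. \<Prod>n=1..N.
            ((\<Prod>j=1..i. of_nat n + a j) / (\<Prod>j=1..i. of_nat n + b j)) ^ n)
         \<longlonglongrightarrow> (\<Prod>j=1..i. Barnes_G (a j + 1)) / (\<Prod>j=1..i. Barnes_G (b j + 1))"
proof -
  let ?P = "\<lambda>w N. \<Prod>n=1..N. Barnes_factor w n"
  let ?L = "\<lambda>w. Barnes_G (w + 1) / Barnes_prefactor w"
  have "(\<lambda>N. (\<Prod>j=1..i. ?P (a j) N) / (\<Prod>j=1..i. ?P (b j) N))
          \<longlonglongrightarrow> (\<Prod>j=1..i. ?L (a j)) / (\<Prod>j=1..i. ?L (b j))"
    using assms(2,3) Barnes_product_tendsto(2) Barnes_prefactor_nonzero
    by (intro tendsto_divide tendsto_prod Barnes_product_tendsto(1)) auto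
  also have "(\<Prod>j=1..i. ?L (a j)) / (\<Prod>j=1..i. ?L (b j)) =
      (\<Prod>j=1..i. Barnes_G (a j + 1)) / (\<Prod>j=1..i. Barnes_G (b j + 1))"
  proof -
    have "(\<Prod>j=1..i. Barnes_prefactor (a j)) = (\<Prod>j=1..i. Barnes_prefactor (b j))"
      by (simp only: prod_Barnes_prefactor finite_atLeastAtMost assms(4,5))
    moreover have "(\<Prod>j=1..i. Barnes_prefactor (b j)) \<noteq> 0"
      by (simp add: Barnes_prefactor_nonzero)
    ultimately show ?thesis
      by (simp add: prod_dividef)
  qed
  \<comment> \<open>The cancellation is exact for every \<open>N\<close>, factor by factor, once the
    two products are interchanged.\<close>
  also have "(\<lambda>N. (\<Prod>j=1..i. ?P (a j) N) / (\<Prod>j=1..i. ?P (b j) N)) =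
      (\<lambda>N. \<Prod>n=1..N. ((\<Prod>j=1..i. of_nat n + a j) / (\<Prod>j=1..i. of_nat n + b j)) ^ n)"
  proof
    fix N
    have "(\<Prod>j=1..i. ?P (a j) N) / (\<Prod>j=1..i. ?P (b j) N) =
        (\<Prod>n=1..N. (\<Prod>j=1..i. Barnes_factor (a j) n) / (\<Prod>j=1..i. Barnes_factor (b j) n))"
      unfolding prod_dividef by (simp only: prod.swap[of _ "{1..N}"])
    also have "\<dots> = (\<Prod>n=1..N. ((\<Prod>j=1..i. of_nat n + a j) / (\<Prod>j=1..i. of_nat n + b j)) ^ n)"
      \<comment> \<open>The simplifier writes the lower bound 1 as \<open>Suc 0\<close>, so the
        power sum hypotheses are brought to the same form.\<close>
      by (intro prod.cong refl)
         (simp add: prod_Barnes_factor assms(4,5)[unfolded One_nat_def] power_divide)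
    finally show "(\<Prod>j=1..i. ?P (a j) N) / (\<Prod>j=1..i. ?P (b j) N) = \<dots>" .
  qed
  finally show ?thesis .
qed

end
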